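(* Let $(L;\wedge,\vee,^{\Delta},^{\nabla},0,1)$ be a weakly dicomplemented lattice. Let $F(\overline{S}(L))$ be the set of filters of $\overline{S}(L)$, $F(L)$ the set of filters of $L$ and $SF(L)$ the set of S-filters of $L$, all ordered by inclusion. For $G\in F(\overline{S}(L))$ put $F_G=\{x\in L\mid x^{\Delta\Delta}\in G\}$ and $G^{\overline{\star}}=\{x\in\overline{S}(L)\mid a^{\Delta}\le x\ \forall a\in G\}$; for $F\in SF(L)$ put $F^{\star}=\{a\in L\mid x^{\Delta}\le a\ \forall x\in F\}$. Then: (1) the map $\phi:F(\overline{S}(L))\to F(L)$, $G\mapsto F_G$, is injective and order-preserving; (2) the algebras $(F(\overline{S}(L));\cap,\underline{\vee},^{\overline{\star}},\{1\},\overline{S}(L))$ and $(SF(L);\cap,\underline{\vee},^{\star},\{1\},L)$ are isomorphic, where in each $\underline{\vee}$ denotes the join in the respective lattice ordered by inclusion; (3) letting $S(F(\overline{S}(L)))=\{G\in F(\overline{S}(L))\mid G^{\overline{\star}\,\overline{\star}}=G\}$ and $S(SF(L))=\{F\in SF(L)\mid F^{\star\star}=F\}$, each ordered by inclusion and equipped with the complementation $^{\overline{\star}}$, resp. $^{\star}$, these are ortholattices and they are isomorphic ortholattices.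
   Context: A weakly dicomplemented lattice (WDL) is an algebra $(L;\wedge,\vee,^{\Delta},^{\nabla},0,1)$ such that $(L;\wedge,\vee,0,1)$ is a bounded lattice and, for all $x,y\in L$: $x^{\Delta\Delta}\le x$; $x\le y\Rightarrow y^{\Delta}\le x^{\Delta}$; $(x\wedge y)\vee(x\wedge y^{\Delta})=x$; $x^{\nabla\nabla}\ge x$; $x\le y\Rightarrow y^{\nabla}\le x^{\nabla}$; $(x\vee y)\wedge(x\vee y^{\nabla})=x$. A filter of $L$ is a nonempty upward closed subset closed under $\wedge$. $\overline{S}(L)=\{x\in L\mid x^{\Delta\Delta}=x\}$, $x\,\overline{\sqcap}\,y=(x^{\Delta}\vee y^{\Delta})^{\Delta}$; $(\overline{S}(L);\overline{\sqcap},\vee,^{\Delta},0,1)$ is an ortholattice, and a filter of $\overline{S}(L)$ is a nonempty subset of $\overline{S}(L)$ upward closed within $\overline{S}(L)$ and closed under $\overline{\sqcap}$. An S-filter of $L$ is a filter $F$ of $L$ with $x\,\overline{\sqcap}\,y\in F$ whenever $x,y\in F$. An ortholattice is a bounded lattice with an order-reversing involution $^{\perp}$ with $a\vee a^{\perp}=1$ and $a\wedge a^{\perp}=0$. *)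

theory Defs
  imports "HOL-Algebra.Lattice"
begin

record 'a dicomplemented_order = "'a gorder" +
  wcompl  :: "'a \<Rightarrow> 'a"  (\<open>_\<^sup>\<Delta>\<index>\<close> [999] 999)
  dwcompl :: "'a \<Rightarrow> 'a"  (\<open>_\<^sup>\<nabla>\<index>\<close> [999] 999)

locale weakly_dicomplemented_lattice = Lattice.bounded_lattice L
  for L :: "('a, 'm) dicomplemented_order_scheme" (structure) +
  assumes wcompl_closed: "x \<in> carrier L \<Longrightarrow> x\<^sup>\<Delta> \<in> carrier L"
    and wcompl_wcompl_le: "x \<in> carrier L \<Longrightarrow> x\<^sup>\<Delta>\<^sup>\<Delta> \<sqsubseteq> x"
    and wcompl_antitone: "\<lbrakk>x \<in> carrier L; y \<in> carrier L; x \<sqsubseteq> y\<rbrakk> \<Longrightarrow> y\<^sup>\<Delta> \<sqsubseteq> x\<^sup>\<Delta>"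
    and join_meet_wcompl:
      "\<lbrakk>x \<in> carrier L; y \<in> carrier L\<rbrakk> \<Longrightarrow> (x \<sqinter> y) \<squnion> (x \<sqinter> y\<^sup>\<Delta>) = x"
    and dwcompl_closed: "x \<in> carrier L \<Longrightarrow> x\<^sup>\<nabla> \<in> carrier L"
    and le_dwcompl_dwcompl: "x \<in> carrier L \<Longrightarrow> x \<sqsubseteq> x\<^sup>\<nabla>\<^sup>\<nabla>"
    and dwcompl_antitone: "\<lbrakk>x \<in> carrier L; y \<in> carrier L; x \<sqsubseteq> y\<rbrakk> \<Longrightarrow> y\<^sup>\<nabla> \<sqsubseteq> x\<^sup>\<nabla>"
    and meet_join_dwcompl:
      "\<lbrakk>x \<in> carrier L; y \<in> carrier L\<rbrakk> \<Longrightarrow> (x \<squnion> y) \<sqinter> (x \<squnion> y\<^sup>\<nabla>) = x"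

definition filters :: "('a, 'm) dicomplemented_order_scheme \<Rightarrow> 'a set set" where
  "filters L = {F. F \<subseteq> carrier L \<and> F \<noteq> {} \<and>
     (\<forall>x\<in>F. \<forall>y\<in>carrier L. x \<sqsubseteq>\<^bsub>L\<^esub> y \<longrightarrow> y \<in> F) \<and>
     (\<forall>x\<in>F. \<forall>y\<in>F. x \<sqinter>\<^bsub>L\<^esub> y \<in> F)}"

definition skeleton :: "('a, 'm) dicomplemented_order_scheme \<Rightarrow> 'a set" where
  "skeleton L = {x \<in> carrier L. x\<^sup>\<Delta>\<^bsub>L\<^esub>\<^sup>\<Delta>\<^bsub>L\<^esub> = x}"

definition skel_meet :: "('a, 'm) dicomplemented_order_scheme \<Rightarrow> 'a \<Rightarrow> 'a \<Rightarrow> 'a" where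
  "skel_meet L x y = (x\<^sup>\<Delta>\<^bsub>L\<^esub> \<squnion>\<^bsub>L\<^esub> y\<^sup>\<Delta>\<^bsub>L\<^esub>)\<^sup>\<Delta>\<^bsub>L\<^esub>"

definition skel_filters :: "('a, 'm) dicomplemented_order_scheme \<Rightarrow> 'a set set" where
  "skel_filters L = {G. G \<subseteq> skeleton L \<and> G \<noteq> {} \<and>
     (\<forall>x\<in>G. \<forall>y\<in>skeleton L. x \<sqsubseteq>\<^bsub>L\<^esub> y \<longrightarrow> y \<in> G) \<and>
     (\<forall>x\<in>G. \<forall>y\<in>G. skel_meet L x y \<in> G)}"

definition S_filters :: "('a, 'm) dicomplemented_order_scheme \<Rightarrow> 'a set set" where
  "S_filters L = {F \<in> filters L. \<forall>x\<in>F. \<forall>y\<in>F. skel_meet L x y \<in> F}"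

definition filter_of_skel :: "('a, 'm) dicomplemented_order_scheme \<Rightarrow> 'a set \<Rightarrow> 'a set" where
  "filter_of_skel L G = {x \<in> carrier L. x\<^sup>\<Delta>\<^bsub>L\<^esub>\<^sup>\<Delta>\<^bsub>L\<^esub> \<in> G}"

definition skel_star :: "('a, 'm) dicomplemented_order_scheme \<Rightarrow> 'a set \<Rightarrow> 'a set" where
  "skel_star L G = {x \<in> skeleton L. \<forall>a\<in>G. a\<^sup>\<Delta>\<^bsub>L\<^esub> \<sqsubseteq>\<^bsub>L\<^esub> x}"

definition star :: "('a, 'm) dicomplemented_order_scheme \<Rightarrow> 'a set \<Rightarrow> 'a set" where
  "star L F = {a \<in> carrier L. \<forall>x\<in>F. x\<^sup>\<Delta>\<^bsub>L\<^esub> \<sqsubseteq>\<^bsub>L\<^esub> a}"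

definition inclusion_order :: "'a set set \<Rightarrow> 'a set gorder" where
  "inclusion_order \<F> = \<lparr>carrier = \<F>, eq = (=), le = (\<subseteq>)\<rparr>"

definition closed_elements :: "'b set \<Rightarrow> ('b \<Rightarrow> 'b) \<Rightarrow> 'b set" where
  "closed_elements A c = {x \<in> A. c (c x) = x}"

record 'a compl_algebra = "'a partial_object" +
  alg_meet  :: "'a \<Rightarrow> 'a \<Rightarrow> 'a"
  alg_join  :: "'a \<Rightarrow> 'a \<Rightarrow> 'a"
  alg_compl :: "'a \<Rightarrow> 'a"
  alg_zero  :: 'a
  alg_one   :: 'a

locale compl_algebra =
  fixes A :: "('a, 'm) compl_algebra_scheme"
  assumes alg_meet_closed: "\<lbrakk>x \<in> carrier A; y \<in> carrier A\<rbrakk> \<Longrightarrow> alg_meet A x y \<in> carrier A"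
    and alg_join_closed: "\<lbrakk>x \<in> carrier A; y \<in> carrier A\<rbrakk> \<Longrightarrow> alg_join A x y \<in> carrier A"
    and alg_compl_closed: "x \<in> carrier A \<Longrightarrow> alg_compl A x \<in> carrier A"
    and alg_zero_closed: "alg_zero A \<in> carrier A"
    and alg_one_closed: "alg_one A \<in> carrier A"

definition compl_algebra_iso ::
  "('a, 'm) compl_algebra_scheme \<Rightarrow> ('b, 'n) compl_algebra_scheme \<Rightarrow> ('a \<Rightarrow> 'b) set" where
  "compl_algebra_iso A B = {h. bij_betw h (carrier A) (carrier B) \<and>
     (\<forall>x\<in>carrier A. \<forall>y\<in>carrier A. h (alg_meet A x y) = alg_meet B (h x) (h y)) \<and>
     (\<forall>x\<in>carrier A. \<forall>y\<in>carrier A. h (alg_join A x y) = alg_join B (h x) (h y)) \<and>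
     (\<forall>x\<in>carrier A. h (alg_compl A x) = alg_compl B (h x)) \<and>
     h (alg_zero A) = alg_zero B \<and> h (alg_one A) = alg_one B}"

definition compl_algebra_isomorphic ::
  "('a, 'm) compl_algebra_scheme \<Rightarrow> ('b, 'n) compl_algebra_scheme \<Rightarrow> bool" where
  "compl_algebra_isomorphic A B \<longleftrightarrow> compl_algebra_iso A B \<noteq> {}"

text \<open>The library's \<^const>\<open>join\<close> is choice-based: it is the join only where the inclusion order is a lattice.\<close>

definition skel_filter_algebra ::
  "('a, 'm) dicomplemented_order_scheme \<Rightarrow> 'a set compl_algebra" where
  "skel_filter_algebra L =
     \<lparr>carrier = skel_filters L, alg_meet = (\<inter>),
      alg_join = join (inclusion_order (skel_filters L)),
      alg_compl = skel_star L, alg_zero = {\<top>\<^bsub>L\<^esub>}, alg_one = skeleton L\<rparr>"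

definition S_filter_algebra ::
  "('a, 'm) dicomplemented_order_scheme \<Rightarrow> 'a set compl_algebra" where
  "S_filter_algebra L =
     \<lparr>carrier = S_filters L, alg_meet = (\<inter>),
      alg_join = join (inclusion_order (S_filters L)),
      alg_compl = star L, alg_zero = {\<top>\<^bsub>L\<^esub>}, alg_one = carrier L\<rparr>"

locale ortholattice = Lattice.bounded_lattice L
  for L :: "('a, 'm) gorder_scheme" (structure) +
  fixes ocompl :: "'a \<Rightarrow> 'a"
  assumes ocompl_closed: "a \<in> carrier L \<Longrightarrow> ocompl a \<in> carrier L"
    and ocompl_antitone:
      "\<lbrakk>a \<in> carrier L; b \<in> carrier L; a \<sqsubseteq> b\<rbrakk> \<Longrightarrow> ocompl b \<sqsubseteq> ocompl a"
    and ocompl_involution: "a \<in> carrier L \<Longrightarrow> ocompl (ocompl a) = a"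
    and join_ocompl: "a \<in> carrier L \<Longrightarrow> a \<squnion> ocompl a = \<top>"
    and meet_ocompl: "a \<in> carrier L \<Longrightarrow> a \<sqinter> ocompl a = \<bottom>"

definition ortholattice_algebra ::
  "('a, 'm) gorder_scheme \<Rightarrow> ('a \<Rightarrow> 'a) \<Rightarrow> 'a compl_algebra" where
  "ortholattice_algebra P c =
     \<lparr>carrier = carrier P, alg_meet = meet P, alg_join = join P,
      alg_compl = c, alg_zero = \<bottom>\<^bsub>P\<^esub>, alg_one = \<top>\<^bsub>P\<^esub>\<rparr>"

end

theory Submission
  imports Defs
begin

text \<open>
  From the first two axioms for \<open>\<Delta>\<close> one gets
  \<open>(x \<and> y)\<^sup>\<Delta> = x\<^sup>\<Delta> \<or> y\<^sup>\<Delta>\<close>, so the skeleton meet of \<open>x\<close> and \<open>y\<close> is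
  \<open>(x \<and> y)\<^sup>\<Delta>\<^sup>\<Delta>\<close>. Hence an S-filter is a filter closed under \<open>x \<mapsto> x\<^sup>\<Delta>\<^sup>\<Delta>\<close>; since
  \<open>x\<^sup>\<Delta>\<^sup>\<Delta> \<le> x\<close>, it is determined by its trace on the skeleton, and \<open>G \<mapsto> F\<^sub>G\<close> and
  \<open>F \<mapsto> F \<inter> S\<close> are mutually inverse order isomorphisms commuting with the stars.
  Each star is the polarity of the symmetric relation \<open>x\<^sup>\<Delta> \<le> a\<close>, hence a self-adjoint Galois
  connection, and a filter meets its star only in \<open>1\<close> because \<open>x \<or> x\<^sup>\<Delta> = 1\<close>. These two
  properties alone make the closed elements of any intersection-closed family an ortholattice.
\<close>

section \<open>Families of sets ordered by inclusion\<close>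

lemma inclusion_order_simps [simp]:
  "carrier (inclusion_order \<F>) = \<F>"
  "le (inclusion_order \<F>) = (\<subseteq>)"
  "eq (inclusion_order \<F>) = (=)"
  by (simp_all add: inclusion_order_def)

lemma partial_order_inclusion_order: "partial_order (inclusion_order \<F>)"
  by unfold_locales auto

lemma least_Upper_inclusion_order:
  assumes "Z \<in> \<F>" "X \<in> \<F>" "Y \<in> \<F>" "X \<subseteq> Z" "Y \<subseteq> Z"
    and "\<And>W. \<lbrakk>W \<in> \<F>; X \<subseteq> W; Y \<subseteq> W\<rbrakk> \<Longrightarrow> Z \<subseteq> W"
  shows "least (inclusion_order \<F>) Z (Upper (inclusion_order \<F>) {X, Y})"
  using assms by (auto simp: least_def Upper_def)

lemma greatest_Lower_inclusion_order:
  assumes "Z \<in> \<F>" "X \<in> \<F>" "Y \<in> \<F>" "Z \<subseteq> X" "Z \<subseteq> Y"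
    and "\<And>W. \<lbrakk>W \<in> \<F>; W \<subseteq> X; W \<subseteq> Y\<rbrakk> \<Longrightarrow> W \<subseteq> Z"
  shows "greatest (inclusion_order \<F>) Z (Lower (inclusion_order \<F>) {X, Y})"
  using assms by (auto simp: greatest_def Lower_def)

text \<open>\<open>join\<close> picks some least upper bound by choice; antisymmetry of inclusion
  leaves a single candidate, so exhibiting one determines the value.\<close>

lemma join_inclusion_order_eqI:
  assumes "Z \<in> \<F>" "X \<in> \<F>" "Y \<in> \<F>" "X \<subseteq> Z" "Y \<subseteq> Z"
    and "\<And>W. \<lbrakk>W \<in> \<F>; X \<subseteq> W; Y \<subseteq> W\<rbrakk> \<Longrightarrow> Z \<subseteq> W"
  shows "join (inclusion_order \<F>) X Y = Z"
proof -
  have "least (inclusion_order \<F>) Z (Upper (inclusion_order \<F>) {X, Y})"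
    by (rule least_Upper_inclusion_order) (fact assms)+
  then show ?thesis
    unfolding join_def sup_def
    by (intro some_equality partial_order.least_unique[OF partial_order_inclusion_order])
qed

lemma meet_inclusion_order_eqI:
  assumes "Z \<in> \<F>" "X \<in> \<F>" "Y \<in> \<F>" "Z \<subseteq> X" "Z \<subseteq> Y"
    and "\<And>W. \<lbrakk>W \<in> \<F>; W \<subseteq> X; W \<subseteq> Y\<rbrakk> \<Longrightarrow> W \<subseteq> Z"
  shows "meet (inclusion_order \<F>) X Y = Z"
proof -
  have "greatest (inclusion_order \<F>) Z (Lower (inclusion_order \<F>) {X, Y})"
    by (rule greatest_Lower_inclusion_order) (fact assms)+
  then show ?thesis
    unfolding meet_def inf_def
    by (intro some_equality partial_order.greatest_unique[OF partial_order_inclusion_order])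
qed

lemma top_inclusion_order_eqI:
  assumes "U \<in> \<F>" "\<And>X. X \<in> \<F> \<Longrightarrow> X \<subseteq> U"
  shows "\<top>\<^bsub>inclusion_order \<F>\<^esub> = U"
  unfolding Order.top_def using assms by (intro some_equality) (auto simp: greatest_def)

lemma bottom_inclusion_order_eqI:
  assumes "B \<in> \<F>" "\<And>X. X \<in> \<F> \<Longrightarrow> B \<subseteq> X"
  shows "\<bottom>\<^bsub>inclusion_order \<F>\<^esub> = B"
  unfolding bottom_def using assms by (intro some_equality) (auto simp: least_def)

text \<open>A closure system on \<open>U\<close>. Only nonempty families are intersected, since
  \<open>\<Inter>{}\<close> is \<open>UNIV\<close>; membership of \<open>U\<close> is therefore
  required separately.\<close>

locale intersection_closed_family =
  fixes \<F> :: "'b set set" and U :: "'b set"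
  assumes Inter_closed: "\<lbrakk>\<A> \<subseteq> \<F>; \<A> \<noteq> {}\<rbrakk> \<Longrightarrow> \<Inter>\<A> \<in> \<F>"
    and U_closed: "U \<in> \<F>"
    and subset_U: "X \<in> \<F> \<Longrightarrow> X \<subseteq> U"
begin

abbreviation generated :: "'b set \<Rightarrow> 'b set \<Rightarrow> 'b set" where
  "generated X Y \<equiv> \<Inter>{Z \<in> \<F>. X \<subseteq> Z \<and> Y \<subseteq> Z}"

lemma generated_closed: "\<lbrakk>X \<in> \<F>; Y \<in> \<F>\<rbrakk> \<Longrightarrow> generated X Y \<in> \<F>"
  \<comment> \<open>\<open>U\<close> belongs to the family being intersected, which is therefore
    nonempty.\<close>
  using U_closed subset_U by (intro Inter_closed) auto

lemma Int_closed: "\<lbrakk>X \<in> \<F>; Y \<in> \<F>\<rbrakk> \<Longrightarrow> X \<inter> Y \<in> \<F>"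
  using Inter_closed[of "{X, Y}"] by auto

lemma join_eq: "\<lbrakk>X \<in> \<F>; Y \<in> \<F>\<rbrakk> \<Longrightarrow> join (inclusion_order \<F>) X Y = generated X Y"
  by (rule join_inclusion_order_eqI) (auto simp: generated_closed)

lemma meet_eq: "\<lbrakk>X \<in> \<F>; Y \<in> \<F>\<rbrakk> \<Longrightarrow> meet (inclusion_order \<F>) X Y = X \<inter> Y"
  by (rule meet_inclusion_order_eqI) (auto simp: Int_closed)

lemma join_closed: "\<lbrakk>X \<in> \<F>; Y \<in> \<F>\<rbrakk> \<Longrightarrow> join (inclusion_order \<F>) X Y \<in> \<F>"
  by (simp add: join_eq generated_closed)

lemma lattice_inclusion_order: "Lattice.lattice (inclusion_order \<F>)"
proof -
  interpret partial_order "inclusion_order \<F>" by (rule partial_order_inclusion_order)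
  show ?thesis
  proof unfold_locales
    fix X Y assume "X \<in> carrier (inclusion_order \<F>)" "Y \<in> carrier (inclusion_order \<F>)"
    then have XY: "X \<in> \<F>" "Y \<in> \<F>" by simp_all
    show "\<exists>Z. least (inclusion_order \<F>) Z (Upper (inclusion_order \<F>) {X, Y})"
      using XY by (intro exI[of _ "generated X Y"] least_Upper_inclusion_order)
        (auto simp: generated_closed)
    show "\<exists>Z. greatest (inclusion_order \<F>) Z (Lower (inclusion_order \<F>) {X, Y})"
      using XY by (intro exI[of _ "X \<inter> Y"] greatest_Lower_inclusion_order) (auto simp: Int_closed)
  qed
qed

end

text \<open>Joins depend on the order alone: an upper bound \<open>W\<close> of the images is pulled
  back by surjectivity, and the embedding property compares its preimage with the join.\<close>

lemma order_iso_join: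
  assumes F: "intersection_closed_family \<F> U"
    and bij: "bij_betw h \<F> \<G>"
    and emb: "\<And>X Y. \<lbrakk>X \<in> \<F>; Y \<in> \<F>\<rbrakk> \<Longrightarrow> h X \<subseteq> h Y \<longleftrightarrow> X \<subseteq> Y"
    and XY: "X \<in> \<F>" "Y \<in> \<F>"
  shows "h (join (inclusion_order \<F>) X Y) = join (inclusion_order \<G>) (h X) (h Y)"
proof (rule sym, rule join_inclusion_order_eqI)
  interpret intersection_closed_family \<F> U by (rule F)
  let ?J = "join (inclusion_order \<F>) X Y"
  have J: "?J \<in> \<F>" using XY by (rule join_closed)
  have hG: "h Z \<in> \<G>" if "Z \<in> \<F>" for Z using bij that by (auto simp: bij_betw_def)
  show "h ?J \<in> \<G>" "h X \<in> \<G>" "h Y \<in> \<G>" using J XY hG by auto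
  have "X \<subseteq> ?J" "Y \<subseteq> ?J" using XY by (auto simp: join_eq)
  then show "h X \<subseteq> h ?J" "h Y \<subseteq> h ?J" using J XY emb by auto
  fix W assume W: "W \<in> \<G>" "h X \<subseteq> W" "h Y \<subseteq> W"
  then obtain W' where W': "W' \<in> \<F>" "W = h W'" using bij by (auto simp: bij_betw_def)
  then have "X \<subseteq> W'" "Y \<subseteq> W'" using W XY emb by auto
  then have "?J \<subseteq> W'" using W' XY by (auto simp: join_eq)
  then show "h ?J \<subseteq> W" using W' J emb by auto
qed

text \<open>Intersection is the meet in both families. As \<open>h X \<inter> h Y\<close> lies in
  \<open>\<G>\<close>, it has a preimage \<open>W\<close>, which the embedding places below
  \<open>X\<close> and \<open>Y\<close>.\<close>

lemma order_iso_Int: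
  assumes F: "intersection_closed_family \<F> U" and G: "intersection_closed_family \<G> V"
    and bij: "bij_betw h \<F> \<G>"
    and emb: "\<And>X Y. \<lbrakk>X \<in> \<F>; Y \<in> \<F>\<rbrakk> \<Longrightarrow> h X \<subseteq> h Y \<longleftrightarrow> X \<subseteq> Y"
    and XY: "X \<in> \<F>" "Y \<in> \<F>"
  shows "h (X \<inter> Y) = h X \<inter> h Y"
proof
  interpret F: intersection_closed_family \<F> U by (rule F)
  interpret G: intersection_closed_family \<G> V by (rule G)
  have hG: "h Z \<in> \<G>" if "Z \<in> \<F>" for Z using bij that by (auto simp: bij_betw_def)
  have I: "X \<inter> Y \<in> \<F>" using XY by (rule F.Int_closed)
  show "h (X \<inter> Y) \<subseteq> h X \<inter> h Y" using I XY emb by auto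
  have "h X \<inter> h Y \<in> \<G>" using XY hG by (blast intro: G.Int_closed)
  then obtain W where W: "W \<in> \<F>" "h X \<inter> h Y = h W" using bij by (auto simp: bij_betw_def)
  then have "W \<subseteq> X" "W \<subseteq> Y" using XY emb by blast+
  then show "h X \<inter> h Y \<subseteq> h (X \<inter> Y)" using W I emb by simp
qed

section \<open>Ortholattices of closed sets\<close>

text \<open>\<open>compl_adjoint\<close> says that \<open>c\<close> forms an antitone Galois
  connection with itself, so \<open>c \<circ> c\<close> is a closure operator. The meet law over the
  least member \<open>B\<close> is imposed; the join law is derived later, on the closed
  members.\<close>

locale complemented_family = intersection_closed_family \<F> U
  for \<F> :: "'b set set" and U :: "'b set" +
  fixes B :: "'b set" and c :: "'b set \<Rightarrow> 'b set"
  assumes compl_closed: "X \<in> \<F> \<Longrightarrow> c X \<in> \<F>"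
    and compl_adjoint: "\<lbrakk>X \<in> \<F>; Y \<in> \<F>; X \<subseteq> c Y\<rbrakk> \<Longrightarrow> Y \<subseteq> c X"
    and B_closed: "B \<in> \<F>"
    and B_subset: "X \<in> \<F> \<Longrightarrow> B \<subseteq> X"
    and Int_compl: "X \<in> \<F> \<Longrightarrow> X \<inter> c X = B"
begin

abbreviation "\<C> \<equiv> closed_elements \<F> c"

lemma closedD: "X \<in> \<C> \<Longrightarrow> X \<in> \<F>" "X \<in> \<C> \<Longrightarrow> c (c X) = X"
  by (simp_all add: closed_elements_def)

text \<open>Adjointness applied to \<open>c X \<subseteq> c X\<close>.\<close>

lemma subset_compl_compl: "X \<in> \<F> \<Longrightarrow> X \<subseteq> c (c X)"
  using compl_adjoint compl_closed by blast

text \<open>Adjointness turns \<open>X \<subseteq> Y \<subseteq> c (c Y)\<close> around.\<close>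

lemma compl_antitone: "\<lbrakk>X \<in> \<F>; Y \<in> \<F>; X \<subseteq> Y\<rbrakk> \<Longrightarrow> c Y \<subseteq> c X"
  using compl_adjoint[of X "c Y"] subset_compl_compl[of Y] compl_closed by blast

lemma compl_U: "c U = B"
  using Int_compl[OF U_closed] subset_U[OF compl_closed[OF U_closed]] by blast

lemma compl_B: "c B = U"
  using compl_adjoint[OF B_closed U_closed] compl_U subset_U[OF compl_closed[OF B_closed]] by blast

text \<open>The monotone map \<open>c \<circ> c\<close> fixes each member of \<open>\<A>\<close>, so
  it sends the intersection below every member; being inflationary, it fixes the
  intersection.\<close>

lemma closed_intersection_closed_family: "intersection_closed_family \<C> U"
proof
  fix \<A> assume A: "\<A> \<subseteq> \<C>" "\<A> \<noteq> {}"
  then have I: "\<Inter>\<A> \<in> \<F>" using closedD(1) by (intro Inter_closed) auto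
  have "c (c (\<Inter>\<A>)) \<subseteq> X" if X: "X \<in> \<A>" for X
  proof -
    have X': "X \<in> \<C>" using A X by blast
    have "c (c (\<Inter>\<A>)) \<subseteq> c (c X)"
      using closedD(1)[OF X'] I X by (intro compl_antitone compl_closed) auto
    then show ?thesis using closedD(2)[OF X'] by simp
  qed
  then have "c (c (\<Inter>\<A>)) = \<Inter>\<A>" using subset_compl_compl[OF I] by blast
  with I show "\<Inter>\<A> \<in> \<C>" by (simp add: closed_elements_def)
next
  show "U \<in> \<C>" by (simp add: closed_elements_def U_closed compl_U compl_B)
qed (simp add: closed_elements_def subset_U)

sublocale closed: intersection_closed_family \<C> U
  by (rule closed_intersection_closed_family)

lemma B_in_closed: "B \<in> \<C>"
  by (simp add: closed_elements_def B_closed compl_U compl_B)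

lemma top_closed_eq: "\<top>\<^bsub>inclusion_order \<C>\<^esub> = U"
  by (rule top_inclusion_order_eqI) (use closed.U_closed closed.subset_U in auto)

lemma bottom_closed_eq: "\<bottom>\<^bsub>inclusion_order \<C>\<^esub> = B"
  by (rule bottom_inclusion_order_eqI) (use B_in_closed B_subset closedD in auto)

lemma compl_in_closed: "X \<in> \<C> \<Longrightarrow> c X \<in> \<C>"
  by (simp add: closed_elements_def compl_closed)

lemma ortholattice_closed: "ortholattice (inclusion_order \<C>) c"
proof -
  interpret Lattice.lattice "inclusion_order \<C>" by (rule closed.lattice_inclusion_order)
  show ?thesis
  proof unfold_locales
    show "\<exists>X. least (inclusion_order \<C>) X (carrier (inclusion_order \<C>))"
      using B_in_closed B_subset closedD by (intro exI[of _ B]) (auto simp: least_def)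
    show "\<exists>X. greatest (inclusion_order \<C>) X (carrier (inclusion_order \<C>))"
      using closed.U_closed closed.subset_U by (intro exI[of _ U]) (auto simp: greatest_def)
  next
    fix X assume "X \<in> carrier (inclusion_order \<C>)"
    then have X: "X \<in> \<C>" by simp
    show "c X \<in> carrier (inclusion_order \<C>)" using X by (simp add: compl_in_closed)
    show "c (c X) = X" using X by (rule closedD)
    show "X \<sqinter>\<^bsub>inclusion_order \<C>\<^esub> c X = \<bottom>\<^bsub>inclusion_order \<C>\<^esub>"
      using X by (simp add: closed.meet_eq compl_in_closed bottom_closed_eq Int_compl closedD)
    show "X \<squnion>\<^bsub>inclusion_order \<C>\<^esub> c X = \<top>\<^bsub>inclusion_order \<C>\<^esub>"
      unfolding top_closed_eq
    proof (rule join_inclusion_order_eqI)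
      fix W assume W: "W \<in> \<C>" "X \<subseteq> W" "c X \<subseteq> W"
      have F: "W \<in> \<F>" "X \<in> \<F>" "c X \<in> \<F>" "c W \<in> \<F>" using W X closedD compl_closed by auto
      \<comment> \<open>An upper bound \<open>W\<close> of \<open>X\<close> and \<open>c X\<close>
        has its complement below both \<open>c X\<close> and \<open>c (c X)\<close>, hence below
        \<open>B\<close>; complementing again forces \<open>W\<close> to contain
        \<open>U\<close>.\<close>
      have "c W \<subseteq> c X \<inter> c (c X)" using F W compl_antitone by blast
      then have "c W \<subseteq> B" using F by (simp add: Int_compl)
      then have "c B \<subseteq> c (c W)" using F by (intro compl_antitone B_closed)
      then show "U \<subseteq> W" using W by (simp add: closedD compl_B)
    qed (use X compl_in_closed closed.U_closed closed.subset_U in auto)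
  next
    fix X Y
    assume "X \<in> carrier (inclusion_order \<C>)" "Y \<in> carrier (inclusion_order \<C>)"
      "X \<sqsubseteq>\<^bsub>inclusion_order \<C>\<^esub> Y"
    then show "c Y \<sqsubseteq>\<^bsub>inclusion_order \<C>\<^esub> c X" using closedD compl_antitone by simp
  qed
qed

end

text \<open>A bijection commuting with complements preserves and reflects closedness, so it
  restricts to the closed elements. Joins there are taken in the smaller family and may exceed those
  of \<open>\<F>\<close>; hence the transfer lemmas are applied afresh to the restricted
  isomorphism.\<close>

lemma order_iso_closed_elements:
  assumes F: "complemented_family \<F> U B c" and G: "complemented_family \<G> V D d"
    and bij: "bij_betw h \<F> \<G>"
    and emb: "\<And>X Y. \<lbrakk>X \<in> \<F>; Y \<in> \<F>\<rbrakk> \<Longrightarrow> h X \<subseteq> h Y \<longleftrightarrow> X \<subseteq> Y"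
    and compl: "\<And>X. X \<in> \<F> \<Longrightarrow> h (c X) = d (h X)"
    and U: "h U = V" and B: "h B = D"
  shows "h \<in> compl_algebra_iso
    (ortholattice_algebra (inclusion_order (closed_elements \<F> c)) c)
    (ortholattice_algebra (inclusion_order (closed_elements \<G> d)) d)"
proof -
  interpret F: complemented_family \<F> U B c by (rule F)
  interpret G: complemented_family \<G> V D d by (rule G)
  have inj: "inj_on h \<F>" and img: "h ` \<F> = \<G>" using bij by (auto simp: bij_betw_def)
  have iff: "h X \<in> closed_elements \<G> d \<longleftrightarrow> X \<in> closed_elements \<F> c" if X: "X \<in> \<F>" for X
  proof -
    have "h (c (c X)) = d (d (h X))" using X by (simp add: compl F.compl_closed)
    \<comment> \<open>Injectivity is what reflects closedness back to \<open>\<F>\<close>.\<close>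
    moreover have "h (c (c X)) = h X \<longleftrightarrow> c (c X) = X"
      using inj X F.compl_closed by (auto simp: inj_on_eq_iff)
    ultimately show ?thesis using X img by (auto simp: closed_elements_def)
  qed
  have bij': "bij_betw h (closed_elements \<F> c) (closed_elements \<G> d)"
    unfolding bij_betw_def
  proof
    show "inj_on h (closed_elements \<F> c)" using inj by (rule inj_on_subset) (auto dest: F.closedD)
    show "h ` closed_elements \<F> c = closed_elements \<G> d"
    proof
      show "h ` closed_elements \<F> c \<subseteq> closed_elements \<G> d" using iff F.closedD by auto
      show "closed_elements \<G> d \<subseteq> h ` closed_elements \<F> c"
      proof
        fix Y assume Y: "Y \<in> closed_elements \<G> d"
        then obtain X where "X \<in> \<F>" "Y = h X" using img G.closedD by auto
        with Y iff show "Y \<in> h ` closed_elements \<F> c" by auto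
      qed
    qed
  qed
  have emb': "h X \<subseteq> h Y \<longleftrightarrow> X \<subseteq> Y"
    if "X \<in> closed_elements \<F> c" "Y \<in> closed_elements \<F> c" for X Y
    using that F.closedD emb by auto
  note iso = F.closed_intersection_closed_family G.closed_intersection_closed_family bij' emb'
  \<comment> \<open>\<open>G.closed.meet_eq\<close> rewrites the meet of two images only once these
    are known to be closed.\<close>
  have hC: "h X \<in> closed_elements \<G> d" if "X \<in> closed_elements \<F> c" for X
    using that iff F.closedD by auto
  show ?thesis
    using bij' order_iso_join[OF F.closed_intersection_closed_family bij' emb']
      order_iso_Int[OF iso] hC
    by (auto simp: compl_algebra_iso_def ortholattice_algebra_def F.closed.meet_eq G.closed.meet_eq
        F.top_closed_eq G.top_closed_eq F.bottom_closed_eq G.bottom_closed_eq U B compl F.closedD)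
qed

section \<open>Filters of a weakly dicomplemented lattice\<close>

context weakly_dicomplemented_lattice
begin

section \<open>Calculus of the weak complement\<close>

lemma wcompl_wcompl_wcompl: "x \<in> carrier L \<Longrightarrow> x\<^sup>\<Delta>\<^sup>\<Delta>\<^sup>\<Delta> = x\<^sup>\<Delta>"
  by (meson le_antisym wcompl_antitone wcompl_closed wcompl_wcompl_le)

text \<open>\<open>y\<^sup>\<Delta> \<sqsubseteq> x\<^sup>\<Delta>\<^sup>\<Delta> \<sqsubseteq>
  x\<close>. This symmetry is what makes each star adjoint to itself.\<close>

lemma wcompl_le_swap: "\<lbrakk>x \<in> carrier L; y \<in> carrier L; x\<^sup>\<Delta> \<sqsubseteq> y\<rbrakk> \<Longrightarrow> y\<^sup>\<Delta> \<sqsubseteq> x"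
  by (meson le_trans wcompl_antitone wcompl_closed wcompl_wcompl_le)

text \<open>The double complement is monotone and fixes \<open>x\<^sup>\<Delta>\<close>, so applying
  it to \<open>x\<^sup>\<Delta> \<sqsubseteq> y\<close> changes only the right side; the converse is
  deflation.\<close>

lemma wcompl_le_wcompl_wcompl_iff:
  assumes "x \<in> carrier L" "y \<in> carrier L"
  shows "x\<^sup>\<Delta> \<sqsubseteq> y\<^sup>\<Delta>\<^sup>\<Delta> \<longleftrightarrow> x\<^sup>\<Delta> \<sqsubseteq> y"
proof
  show "x\<^sup>\<Delta> \<sqsubseteq> y" if "x\<^sup>\<Delta> \<sqsubseteq> y\<^sup>\<Delta>\<^sup>\<Delta>"
    using that assms by (meson le_trans wcompl_closed wcompl_wcompl_le)
  show "x\<^sup>\<Delta> \<sqsubseteq> y\<^sup>\<Delta>\<^sup>\<Delta>" if "x\<^sup>\<Delta> \<sqsubseteq> y"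
    using that assms wcompl_antitone[of "y\<^sup>\<Delta>" "x\<^sup>\<Delta>\<^sup>\<Delta>"] wcompl_antitone[of "x\<^sup>\<Delta>" y]
    by (simp add: wcompl_closed wcompl_wcompl_wcompl)
qed

text \<open>The nontrivial inequality swaps twice: \<open>?z\<close> is above both complements, so
  \<open>?z\<^sup>\<Delta>\<close> is below \<open>x\<close> and \<open>y\<close>, hence below their
  meet, and swapping back bounds the complement of the meet by \<open>?z\<close>.\<close>

lemma wcompl_meet:
  assumes x: "x \<in> carrier L" and y: "y \<in> carrier L"
  shows "(x \<sqinter> y)\<^sup>\<Delta> = x\<^sup>\<Delta> \<squnion> y\<^sup>\<Delta>"
proof (rule le_antisym)
  let ?z = "x\<^sup>\<Delta> \<squnion> y\<^sup>\<Delta>"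
  have cl: "x \<sqinter> y \<in> carrier L" "?z \<in> carrier L" "x\<^sup>\<Delta> \<in> carrier L" "y\<^sup>\<Delta> \<in> carrier L"
    using x y by (simp_all add: wcompl_closed)
  have "?z\<^sup>\<Delta> \<sqsubseteq> x" "?z\<^sup>\<Delta> \<sqsubseteq> y"
    using cl x y by (auto intro: wcompl_le_swap join_left join_right)
  then have "?z\<^sup>\<Delta> \<sqsubseteq> x \<sqinter> y" using x y cl by (intro meet_le) (auto simp: wcompl_closed)
  then show "(x \<sqinter> y)\<^sup>\<Delta> \<sqsubseteq> ?z" by (rule wcompl_le_swap[OF cl(2,1)])
  show "?z \<sqsubseteq> (x \<sqinter> y)\<^sup>\<Delta>"
    using x y cl by (intro join_le wcompl_antitone) (auto simp: wcompl_closed meet_left meet_right)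
qed (use x y in \<open>simp_all add: wcompl_closed\<close>)

lemma skel_meet_eq: "\<lbrakk>x \<in> carrier L; y \<in> carrier L\<rbrakk> \<Longrightarrow> skel_meet L x y = (x \<sqinter> y)\<^sup>\<Delta>\<^sup>\<Delta>"
  by (simp add: skel_meet_def wcompl_meet)

text \<open>The axiom \<open>join_meet_wcompl\<close> with \<open>\<top>\<close> as its first
  argument.\<close>

lemma join_wcompl: "x \<in> carrier L \<Longrightarrow> x \<squnion> x\<^sup>\<Delta> = \<top>"
  using join_meet_wcompl[of \<top> x] top_meet[of x] top_meet[of "x\<^sup>\<Delta>"] eq_is_equal
  by (simp add: wcompl_closed)

text \<open>An element common to a filter and its star is related to itself in this way. Joining
  \<open>x\<close> with \<open>x\<^sup>\<Delta>\<close> then adds nothing to \<open>x\<close>, yet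
  the join is \<open>\<top>\<close>.\<close>

lemma wcompl_le_self_imp_top:
  assumes x: "x \<in> carrier L" and le: "x\<^sup>\<Delta> \<sqsubseteq> x"
  shows "x = \<top>"
proof -
  have "x \<squnion> x\<^sup>\<Delta> \<sqsubseteq> x" using x le by (intro join_le) (auto simp: wcompl_closed)
  then show ?thesis using x by (intro le_antisym) (auto simp: join_wcompl)
qed

lemma wcompl_bottom: "\<bottom>\<^sup>\<Delta> = \<top>"
  by (metis bottom_closed bottom_join eq_is_equal join_wcompl wcompl_closed)

lemma wcompl_top: "\<top>\<^sup>\<Delta> = \<bottom>"
  by (metis bottom_closed bottom_lower le_antisym top_closed wcompl_bottom wcompl_closed
      wcompl_wcompl_le)

text \<open>By deflation, only \<open>\<top>\<close> can lie above \<open>\<top>\<close>; this makes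
  the zeros of the two filter algebras correspond.\<close>

lemma wcompl_wcompl_eq_top_iff: "x \<in> carrier L \<Longrightarrow> x\<^sup>\<Delta>\<^sup>\<Delta> = \<top> \<longleftrightarrow> x = \<top>"
  by (metis le_antisym top_closed top_higher wcompl_bottom wcompl_top wcompl_wcompl_le)

section \<open>The skeleton and its meet\<close>

lemma skeletonD: "x \<in> skeleton L \<Longrightarrow> x \<in> carrier L" "x \<in> skeleton L \<Longrightarrow> x\<^sup>\<Delta>\<^sup>\<Delta> = x"
  by (simp_all add: skeleton_def)

lemma wcompl_in_skeleton: "x \<in> carrier L \<Longrightarrow> x\<^sup>\<Delta> \<in> skeleton L"
  by (simp add: skeleton_def wcompl_closed wcompl_wcompl_wcompl)

lemma top_in_skeleton: "\<top> \<in> skeleton L"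
  by (simp add: skeleton_def wcompl_top wcompl_bottom)

lemma skel_meet_in_skeleton:
  "\<lbrakk>x \<in> carrier L; y \<in> carrier L\<rbrakk> \<Longrightarrow> skel_meet L x y \<in> skeleton L"
  by (simp add: skel_meet_eq wcompl_closed wcompl_in_skeleton)

text \<open>\<open>skel_meet L x y\<close> may lie strictly below \<open>x \<sqinter> y\<close>, but
  lower bounds taken from the skeleton do not see the difference.\<close>

lemma le_skel_meet:
  assumes "z \<in> skeleton L" "x \<in> carrier L" "y \<in> carrier L" "z \<sqsubseteq> x" "z \<sqsubseteq> y"
  shows "z \<sqsubseteq> skel_meet L x y"
proof -
  \<comment> \<open>Writing \<open>z\<close> as the complement of \<open>z\<^sup>\<Delta>\<close>
    gives the form that \<open>wcompl_le_wcompl_wcompl_iff\<close> handles.\<close>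
  have "z\<^sup>\<Delta>\<^sup>\<Delta> \<sqsubseteq> (x \<sqinter> y)"
    using assms by (simp add: skeletonD meet_le)
  then have "z\<^sup>\<Delta>\<^sup>\<Delta> \<sqsubseteq> (x \<sqinter> y)\<^sup>\<Delta>\<^sup>\<Delta>"
    using assms by (simp add: wcompl_le_wcompl_wcompl_iff skeletonD(1) wcompl_closed)
  then show ?thesis using assms by (simp add: skel_meet_eq skeletonD)
qed

section \<open>Correspondence between filters of the skeleton and S-filters\<close>

lemma filter_of_skel_Int_skeleton: "G \<subseteq> skeleton L \<Longrightarrow> filter_of_skel L G \<inter> skeleton L = G"
  by (auto simp: filter_of_skel_def skeleton_def)

lemma skel_filtersD:
  assumes "G \<in> skel_filters L"
  shows "G \<subseteq> skeleton L" "G \<noteq> {}" "\<lbrakk>x \<in> G; y \<in> skeleton L; x \<sqsubseteq> y\<rbrakk> \<Longrightarrow> y \<in> G"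
    "\<lbrakk>x \<in> G; y \<in> G\<rbrakk> \<Longrightarrow> skel_meet L x y \<in> G"
  using assms by (auto simp: skel_filters_def)

text \<open>On the diagonal the skeleton meet is the double complement; in general it is the double
  complement of \<open>x \<sqinter> y\<close>, which a filter already contains.\<close>

lemma S_filters_iff:
  "F \<in> S_filters L \<longleftrightarrow> F \<in> filters L \<and> (\<forall>x\<in>F. x\<^sup>\<Delta>\<^sup>\<Delta> \<in> F)"
proof -
  have "skel_meet L x x = x\<^sup>\<Delta>\<^sup>\<Delta>" if "x \<in> carrier L" for x
  proof -
    have "x \<sqinter> x = x" using that le_iff_join[of x x] by simp
    with that show ?thesis by (simp add: skel_meet_eq)
  qed
  then have "(\<forall>x\<in>F. \<forall>y\<in>F. skel_meet L x y \<in> F) \<longleftrightarrow> (\<forall>x\<in>F. x\<^sup>\<Delta>\<^sup>\<Delta> \<in> F)" if "F \<in> filters L"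
    using that skel_meet_eq unfolding filters_def by (smt (verit) mem_Collect_eq subset_iff)
  then show ?thesis by (auto simp: S_filters_def)
qed

lemma S_filtersD:
  assumes "F \<in> S_filters L"
  shows "F \<subseteq> carrier L" "F \<noteq> {}" "\<lbrakk>x \<in> F; y \<in> carrier L; x \<sqsubseteq> y\<rbrakk> \<Longrightarrow> y \<in> F"
    "\<lbrakk>x \<in> F; y \<in> F\<rbrakk> \<Longrightarrow> x \<sqinter> y \<in> F" "\<lbrakk>x \<in> F; y \<in> F\<rbrakk> \<Longrightarrow> skel_meet L x y \<in> F"
    "x \<in> F \<Longrightarrow> x\<^sup>\<Delta>\<^sup>\<Delta> \<in> F"
proof -
  have "F \<in> filters L" "\<forall>x\<in>F. \<forall>y\<in>F. skel_meet L x y \<in> F" "\<forall>x\<in>F. x\<^sup>\<Delta>\<^sup>\<Delta> \<in> F"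
    using assms S_filters_iff[of F] by (simp_all add: S_filters_def)
  then show "F \<subseteq> carrier L" "F \<noteq> {}" "\<lbrakk>x \<in> F; y \<in> carrier L; x \<sqsubseteq> y\<rbrakk> \<Longrightarrow> y \<in> F"
    "\<lbrakk>x \<in> F; y \<in> F\<rbrakk> \<Longrightarrow> x \<sqinter> y \<in> F" "\<lbrakk>x \<in> F; y \<in> F\<rbrakk> \<Longrightarrow> skel_meet L x y \<in> F"
    "x \<in> F \<Longrightarrow> x\<^sup>\<Delta>\<^sup>\<Delta> \<in> F"
    by (simp_all add: filters_def)
qed

lemma top_in_skel_filter: "G \<in> skel_filters L \<Longrightarrow> \<top> \<in> G"
  using skel_filtersD(1,2)[of G] skel_filtersD(3)[of G _ \<top>] skeletonD(1) top_in_skeleton top_higher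
  by (metis ex_in_conv subsetD)

lemma top_in_S_filter: "F \<in> S_filters L \<Longrightarrow> \<top> \<in> F"
  using S_filtersD(1,2)[of F] S_filtersD(3)[of F _ \<top>] top_closed top_higher
  by (metis ex_in_conv subsetD)

lemma filter_of_skel_in_S_filters:
  assumes G: "G \<in> skel_filters L"
  shows "filter_of_skel L G \<in> S_filters L"
  unfolding S_filters_iff filters_def
proof (intro CollectI conjI ballI impI)
  have "\<top> \<in> filter_of_skel L G"
    using top_in_skel_filter[OF G] by (simp add: filter_of_skel_def wcompl_top wcompl_bottom)
  then show "filter_of_skel L G \<noteq> {}" by blast
  fix x assume "x \<in> filter_of_skel L G"
  then have x: "x \<in> carrier L" "x\<^sup>\<Delta>\<^sup>\<Delta> \<in> G" by (simp_all add: filter_of_skel_def)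
  show "x\<^sup>\<Delta>\<^sup>\<Delta> \<in> filter_of_skel L G"
    using x by (simp add: filter_of_skel_def wcompl_closed wcompl_wcompl_wcompl)
  show "y \<in> filter_of_skel L G" if y: "y \<in> carrier L" "x \<sqsubseteq> y" for y
  proof -
    have "x\<^sup>\<Delta>\<^sup>\<Delta> \<sqsubseteq> y\<^sup>\<Delta>\<^sup>\<Delta>" using x y by (simp add: wcompl_antitone wcompl_closed)
    then have "y\<^sup>\<Delta>\<^sup>\<Delta> \<in> G"
      using skel_filtersD(3)[OF G x(2)] y by (simp add: wcompl_in_skeleton wcompl_closed)
    with y show ?thesis by (simp add: filter_of_skel_def)
  qed
  show "x \<sqinter> y \<in> filter_of_skel L G" if "y \<in> filter_of_skel L G" for y
  proof -
    have y: "y \<in> carrier L" "y\<^sup>\<Delta>\<^sup>\<Delta> \<in> G" using that by (simp_all add: filter_of_skel_def)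
    \<comment> \<open>Triple complements collapse, so this element is the double complement of
      \<open>x \<sqinter> y\<close>.\<close>
    have "skel_meet L (x\<^sup>\<Delta>\<^sup>\<Delta>) (y\<^sup>\<Delta>\<^sup>\<Delta>) \<in> G" using skel_filtersD(4)[OF G x(2) y(2)] .
    then show ?thesis
      using x y by (simp add: filter_of_skel_def skel_meet_def wcompl_wcompl_wcompl wcompl_meet)
  qed
qed (simp add: filter_of_skel_def)

lemma S_filter_Int_skeleton:
  assumes F: "F \<in> S_filters L"
  shows "F \<inter> skeleton L \<in> skel_filters L"
  unfolding skel_filters_def
proof (intro CollectI conjI ballI impI)
  show "F \<inter> skeleton L \<noteq> {}" using top_in_S_filter[OF F] top_in_skeleton by blast
  fix x assume x: "x \<in> F \<inter> skeleton L"
  show "y \<in> F \<inter> skeleton L" if "y \<in> skeleton L" "x \<sqsubseteq> y" for y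
    using that x S_filtersD(3)[OF F, of x y] skeletonD(1) by simp
  show "skel_meet L x y \<in> F \<inter> skeleton L" if "y \<in> F \<inter> skeleton L" for y
    using that x S_filtersD(5)[OF F, of x y] skeletonD(1) by (simp add: skel_meet_in_skeleton)
qed simp

text \<open>One inclusion is closure of S-filters under double complement, the other is deflation
  followed by upward closure.\<close>

lemma filter_of_skel_trace:
  assumes F: "F \<in> S_filters L"
  shows "filter_of_skel L (F \<inter> skeleton L) = F"
proof
  show "F \<subseteq> filter_of_skel L (F \<inter> skeleton L)"
    using S_filtersD[OF F] by (auto simp: filter_of_skel_def wcompl_in_skeleton wcompl_closed)
  show "filter_of_skel L (F \<inter> skeleton L) \<subseteq> F"
    using S_filtersD(3)[OF F] wcompl_wcompl_le by (auto simp: filter_of_skel_def)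
qed

lemma bij_betw_filter_of_skel: "bij_betw (filter_of_skel L) (skel_filters L) (S_filters L)"
  by (rule bij_betw_byWitness[where f' = "\<lambda>F. F \<inter> skeleton L"])
    (auto simp: filter_of_skel_Int_skeleton skel_filtersD(1) filter_of_skel_trace
      filter_of_skel_in_S_filters S_filter_Int_skeleton)

lemma filter_of_skel_mono: "G \<subseteq> H \<Longrightarrow> filter_of_skel L G \<subseteq> filter_of_skel L H"
  by (auto simp: filter_of_skel_def)

text \<open>Traces on the skeleton recover \<open>G\<close> and \<open>H\<close>, which makes the
  inclusion reflect.\<close>

lemma filter_of_skel_subset_iff:
  "\<lbrakk>G \<in> skel_filters L; H \<in> skel_filters L\<rbrakk> \<Longrightarrow>
    filter_of_skel L G \<subseteq> filter_of_skel L H \<longleftrightarrow> G \<subseteq> H"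
  by (metis Int_mono filter_of_skel_Int_skeleton filter_of_skel_mono order_refl skel_filtersD(1))

text \<open>The bounds \<open>a\<^sup>\<Delta>\<close> do not distinguish \<open>a\<close> from its
  double complement, so \<open>G\<close> and its filter impose the same ones; nor do such bounds
  distinguish \<open>x\<close> from its double complement.\<close>

lemma filter_of_skel_skel_star:
  assumes G: "G \<in> skel_filters L"
  shows "filter_of_skel L (skel_star L G) = star L (filter_of_skel L G)"
proof -
  have Gc: "a \<in> carrier L" "a\<^sup>\<Delta>\<^sup>\<Delta> = a" if "a \<in> G" for a
    using that skel_filtersD(1)[OF G] skeletonD by auto
  have "(\<forall>a\<in>G. a\<^sup>\<Delta> \<sqsubseteq> x) \<longleftrightarrow> (\<forall>a\<in>filter_of_skel L G. a\<^sup>\<Delta> \<sqsubseteq> x)" for x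
  proof
    show "\<forall>a\<in>filter_of_skel L G. a\<^sup>\<Delta> \<sqsubseteq> x" if "\<forall>a\<in>G. a\<^sup>\<Delta> \<sqsubseteq> x"
    proof
      fix a assume a: "a \<in> filter_of_skel L G"
      then have "a\<^sup>\<Delta>\<^sup>\<Delta>\<^sup>\<Delta> \<sqsubseteq> x" using that by (auto simp: filter_of_skel_def)
      with a show "a\<^sup>\<Delta> \<sqsubseteq> x" by (simp add: wcompl_wcompl_wcompl filter_of_skel_def)
    qed
    show "\<forall>a\<in>G. a\<^sup>\<Delta> \<sqsubseteq> x" if "\<forall>a\<in>filter_of_skel L G. a\<^sup>\<Delta> \<sqsubseteq> x"
      using that Gc by (auto simp: filter_of_skel_def)
  qed
  then show ?thesis
    using Gc by (auto simp: filter_of_skel_def skel_star_def star_def wcompl_in_skeleton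
        wcompl_closed wcompl_le_wcompl_wcompl_iff)
qed

lemma filter_of_skel_top: "filter_of_skel L {\<top>} = {\<top>}"
  by (auto simp: filter_of_skel_def wcompl_wcompl_eq_top_iff)

lemma filter_of_skel_skeleton: "filter_of_skel L (skeleton L) = carrier L"
  by (auto simp: filter_of_skel_def wcompl_in_skeleton wcompl_closed)

section \<open>Complementation on the two families of filters\<close>

lemma skel_star_in_skel_filters:
  assumes G: "G \<subseteq> skeleton L"
  shows "skel_star L G \<in> skel_filters L"
proof -
  \<comment> \<open>The bounds must lie in the skeleton for \<open>le_skel_meet\<close> to apply to
    them.\<close>
  have cl: "a\<^sup>\<Delta> \<in> skeleton L" "a\<^sup>\<Delta> \<in> carrier L" if "a \<in> G" for a
    using that G skeletonD(1) wcompl_in_skeleton wcompl_closed by auto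
  show ?thesis
    unfolding skel_filters_def
  proof (intro CollectI conjI ballI impI)
    have "\<top> \<in> skel_star L G" using cl by (auto simp: skel_star_def top_in_skeleton)
    then show "skel_star L G \<noteq> {}" by blast
    fix x assume x: "x \<in> skel_star L G"
    show "y \<in> skel_star L G" if "y \<in> skeleton L" "x \<sqsubseteq> y" for y
      using that x cl skeletonD(1) le_trans[of _ x y] by (auto simp: skel_star_def)
    show "skel_meet L x y \<in> skel_star L G" if "y \<in> skel_star L G" for y
      using that x cl skeletonD(1)
      by (auto simp: skel_star_def intro: le_skel_meet skel_meet_in_skeleton)
  qed (auto simp: skel_star_def)
qed

text \<open>The upper bounds of a set form a filter; as the elements bounded here are complements,
  the double complement of an upper bound is again one.\<close>

lemma star_in_S_filters:
  assumes F: "F \<subseteq> carrier L"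
  shows "star L F \<in> S_filters L"
proof -
  have cl: "a \<in> carrier L" "a\<^sup>\<Delta> \<in> carrier L" if "a \<in> F" for a
    using that F wcompl_closed by auto
  show ?thesis
    unfolding S_filters_iff filters_def
  proof (intro CollectI conjI ballI impI)
    have "\<top> \<in> star L F" using cl by (auto simp: star_def)
    then show "star L F \<noteq> {}" by blast
    fix x assume x: "x \<in> star L F"
    show "y \<in> star L F" if "y \<in> carrier L" "x \<sqsubseteq> y" for y
      using that x cl le_trans[of _ x y] by (auto simp: star_def)
    show "x \<sqinter> y \<in> star L F" if "y \<in> star L F" for y
      using that x cl by (auto simp: star_def intro: meet_le)
    show "x\<^sup>\<Delta>\<^sup>\<Delta> \<in> star L F"
      using x cl by (auto simp: star_def wcompl_closed wcompl_le_wcompl_wcompl_iff)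
  qed (auto simp: star_def)
qed

lemma complemented_family_skel_filters:
  "complemented_family (skel_filters L) (skeleton L) {\<top>} (skel_star L)"
proof
  fix \<A> assume A: "\<A> \<subseteq> skel_filters L" "\<A> \<noteq> {}"
  have "\<top> \<in> \<Inter>\<A>" using A top_in_skel_filter by auto
  moreover have "\<Inter>\<A> \<subseteq> skeleton L" using A skel_filtersD(1) by blast
  moreover have "y \<in> \<Inter>\<A>" if "x \<in> \<Inter>\<A>" "y \<in> skeleton L" "x \<sqsubseteq> y" for x y
    using that A skel_filtersD(3) by blast
  moreover have "skel_meet L x y \<in> \<Inter>\<A>" if "x \<in> \<Inter>\<A>" "y \<in> \<Inter>\<A>" for x y
    using that A skel_filtersD(4) by blast
  ultimately show "\<Inter>\<A> \<in> skel_filters L" unfolding skel_filters_def by blast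
next
  show "skeleton L \<in> skel_filters L"
    using top_in_skeleton skel_meet_in_skeleton skeletonD(1) by (auto simp: skel_filters_def)
  fix G assume G: "G \<in> skel_filters L"
  show "G \<subseteq> skeleton L" using G by (rule skel_filtersD)
  then show "skel_star L G \<in> skel_filters L" by (rule skel_star_in_skel_filters)
  show "{\<top>} \<subseteq> G" using G by (simp add: top_in_skel_filter)
  show "G \<inter> skel_star L G = {\<top>}"
    using top_in_skel_filter[OF G] top_in_skel_filter[OF \<open>skel_star L G \<in> skel_filters L\<close>]
    by (auto simp: skel_star_def skeletonD(1) intro: wcompl_le_self_imp_top)
next
  fix G H assume *: "G \<in> skel_filters L" "H \<in> skel_filters L" "G \<subseteq> skel_star L H"
  show "H \<subseteq> skel_star L G"
  proof
    fix h assume h: "h \<in> H"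
    then have "h \<in> skeleton L" using *(2) skel_filtersD(1) by blast
    moreover have "g\<^sup>\<Delta> \<sqsubseteq> h" if "g \<in> G" for g
    proof (rule wcompl_le_swap)
      show "h\<^sup>\<Delta> \<sqsubseteq> g" using *(3) that h by (auto simp: skel_star_def)
      show "h \<in> carrier L" "g \<in> carrier L"
        using * h that skel_filtersD(1) skeletonD(1) by blast+
    qed
    ultimately show "h \<in> skel_star L G" by (simp add: skel_star_def)
  qed
next
  have "skel_meet L \<top> \<top> = \<top>"
    using le_skel_meet[of \<top> \<top> \<top>] skel_meet_in_skeleton[of \<top> \<top>] top_in_skeleton skeletonD(1)
    by (intro le_antisym) auto
  then show "{\<top>} \<in> skel_filters L"
    using top_in_skeleton skeletonD(1) by (auto simp: skel_filters_def)
qed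

lemma complemented_family_S_filters:
  "complemented_family (S_filters L) (carrier L) {\<top>} (star L)"
proof
  fix \<A> assume A: "\<A> \<subseteq> S_filters L" "\<A> \<noteq> {}"
  show "\<Inter>\<A> \<in> S_filters L"
    unfolding S_filters_def filters_def
  proof (intro CollectI conjI ballI impI)
    show "\<Inter>\<A> \<subseteq> carrier L" using A S_filtersD(1) by blast
    have "\<top> \<in> \<Inter>\<A>" using A top_in_S_filter by auto
    then show "\<Inter>\<A> \<noteq> {}" by blast
    fix x assume x: "x \<in> \<Inter>\<A>"
    show "y \<in> \<Inter>\<A>" if "y \<in> carrier L" "x \<sqsubseteq> y" for y
      using that x A S_filtersD(3) by blast
    show "x \<sqinter> y \<in> \<Inter>\<A>" if "y \<in> \<Inter>\<A>" for y
      using that x A S_filtersD(4) by blast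
    show "skel_meet L x y \<in> \<Inter>\<A>" if "y \<in> \<Inter>\<A>" for y
      using that x A S_filtersD(5) by blast
  qed
next
  show "carrier L \<in> S_filters L"
    using top_closed unfolding S_filters_iff filters_def
    by (intro CollectI conjI ballI impI) (auto simp: wcompl_closed)
  fix F assume F: "F \<in> S_filters L"
  show "F \<subseteq> carrier L" using F by (rule S_filtersD)
  then show "star L F \<in> S_filters L" by (rule star_in_S_filters)
  show "{\<top>} \<subseteq> F" using F by (simp add: top_in_S_filter)
  show "F \<inter> star L F = {\<top>}"
    using top_in_S_filter[OF F] top_in_S_filter[OF \<open>star L F \<in> S_filters L\<close>]
    by (auto simp: star_def intro: wcompl_le_self_imp_top)
next
  fix F H assume *: "F \<in> S_filters L" "H \<in> S_filters L" "F \<subseteq> star L H"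
  show "H \<subseteq> star L F"
  proof
    fix h assume h: "h \<in> H"
    then have "h \<in> carrier L" using *(2) S_filtersD(1) by blast
    moreover have "f\<^sup>\<Delta> \<sqsubseteq> h" if "f \<in> F" for f
    proof (rule wcompl_le_swap)
      show "h\<^sup>\<Delta> \<sqsubseteq> f" using *(3) that h by (auto simp: star_def)
      show "h \<in> carrier L" "f \<in> carrier L" using * h that S_filtersD(1) by blast+
    qed
    ultimately show "h \<in> star L F" by (simp add: star_def)
  qed
next
  \<comment> \<open>The trivial S-filter is obtained as the image of the trivial filter of the
    skeleton.\<close>
  have "{\<top>} \<in> skel_filters L"
    using complemented_family_skel_filters by (rule complemented_family.B_closed)
  then show "{\<top>} \<in> S_filters L"
    using filter_of_skel_in_S_filters[of "{\<top>}"] by (simp add: filter_of_skel_top)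
qed

end

theorem theorem4p11:
  fixes L :: "('a, 'm) dicomplemented_order_scheme"
  assumes "weakly_dicomplemented_lattice L"
  shows
    "(filter_of_skel L \<in> skel_filters L \<rightarrow> filters L \<and>
      inj_on (filter_of_skel L) (skel_filters L) \<and>
      isotone (inclusion_order (skel_filters L)) (inclusion_order (filters L)) (filter_of_skel L))
     \<and>
     (Lattice.lattice (inclusion_order (skel_filters L)) \<and>
      Lattice.lattice (inclusion_order (S_filters L)) \<and>
      compl_algebra (skel_filter_algebra L) \<and>
      compl_algebra (S_filter_algebra L) \<and>
      compl_algebra_isomorphic (skel_filter_algebra L) (S_filter_algebra L))
     \<and>
     (let P = inclusion_order (closed_elements (skel_filters L) (skel_star L));
          Q = inclusion_order (closed_elements (S_filters L) (star L))
      in ortholattice P (skel_star L) \<and>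
         ortholattice Q (star L) \<and>
         compl_algebra_isomorphic
           (ortholattice_algebra P (skel_star L)) (ortholattice_algebra Q (star L)))"
proof -
  interpret weakly_dicomplemented_lattice L by (rule assms)
  interpret K: complemented_family "skel_filters L" "skeleton L" "{\<top>\<^bsub>L\<^esub>}" "skel_star L"
    by (rule complemented_family_skel_filters)
  interpret S: complemented_family "S_filters L" "carrier L" "{\<top>\<^bsub>L\<^esub>}" "star L"
    by (rule complemented_family_S_filters)
  have filters: "filter_of_skel L \<in> skel_filters L \<rightarrow> filters L"
    using filter_of_skel_in_S_filters by (auto simp: S_filters_def)
  have inj: "inj_on (filter_of_skel L) (skel_filters L)"
    using bij_betw_filter_of_skel by (rule bij_betw_imp_inj_on)
  have isotone: "isotone (inclusion_order (skel_filters L)) (inclusion_order (filters L))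
      (filter_of_skel L)"
    \<comment> \<open>\<open>isotone\<close> includes the order axioms of both sides besides
      monotonicity.\<close>
    using partial_order_inclusion_order
    by (intro isotoneI) (auto simp: filter_of_skel_def partial_order_def)
  have alg: "compl_algebra (skel_filter_algebra L)" "compl_algebra (S_filter_algebra L)"
    by (unfold_locales; simp add: skel_filter_algebra_def S_filter_algebra_def K.Int_closed
        S.Int_closed K.join_closed S.join_closed K.compl_closed S.compl_closed
        K.B_closed S.B_closed K.U_closed S.U_closed)+
  \<comment> \<open>The same map witnesses both isomorphisms: first on all filters, then restricted
    to the closed ones.\<close>
  have "filter_of_skel L \<in> compl_algebra_iso (skel_filter_algebra L) (S_filter_algebra L)"
    using bij_betw_filter_of_skel
      order_iso_join[OF K.intersection_closed_family_axioms
        bij_betw_filter_of_skel filter_of_skel_subset_iff]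
      order_iso_Int[OF K.intersection_closed_family_axioms S.intersection_closed_family_axioms
        bij_betw_filter_of_skel filter_of_skel_subset_iff]
    by (auto simp: compl_algebra_iso_def skel_filter_algebra_def S_filter_algebra_def
        filter_of_skel_skel_star filter_of_skel_top filter_of_skel_skeleton)
  moreover have "filter_of_skel L \<in> compl_algebra_iso
      (ortholattice_algebra
        (inclusion_order (closed_elements (skel_filters L) (skel_star L))) (skel_star L))
      (ortholattice_algebra (inclusion_order (closed_elements (S_filters L) (star L))) (star L))"
    by (rule order_iso_closed_elements[OF complemented_family_skel_filters
          complemented_family_S_filters bij_betw_filter_of_skel filter_of_skel_subset_iff
          filter_of_skel_skel_star filter_of_skel_skeleton filter_of_skel_top])
  ultimately show ?thesis
    using filters inj isotone alg K.lattice_inclusion_order S.lattice_inclusion_order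
      K.ortholattice_closed S.ortholattice_closed
    unfolding Let_def compl_algebra_isomorphic_def by blast
qed

end
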